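(* Let $n\ge1$, $x_0\in\mathbb{R}^d$, $\bar\Delta>0$. For $i\in\{1,\dots,n\}$ let $f_i:\mathbb{R}^d\to\mathbb{R}$ be continuous and let $\{\widetilde f_{i,\Delta}\}_{\Delta\in(0,\bar\Delta]}$ be a class of models of $f_i$ that provides order-$N_i^f$ function accuracy of $f_i$ at (respectively near) $x_0$ with constant $\kappa_i^f(x_0)$, where $N_i^f\ge0$. Put $F=f_1\cdots f_n$, $\widetilde F_\Delta=\widetilde f_{1,\Delta}\cdots\widetilde f_{n,\Delta}$, $N_F^f=\min\{N_i^f:i=1,\dots,n\}$ and $$K_F^f(x_0)=\min\left\{\sum_{i=1}^n\left(\prod_{j=1}^{i-1}M_{f_{\sigma(j)}}(x_0)\prod_{k=i+1}^nM_{\widetilde f_{\sigma(k)}}(x_0)\right)\kappa_{\sigma(i)}^f(x_0)\bar\Delta^{N_{\sigma(i)}^f-N_F^f}:\sigma\in S_n\right\},$$ where $S_n$ is the permutation group of $\{1,\dots,n\}$. Then for every $\Delta\in(0,\bar\Delta]$: (i) if the accuracy provided is at $x_0$, then $|F(x_0)-\widetilde F_\Delta(x_0)|\le K_F^f(x_0)\Delta^{N_F^f}$; (ii) if the accuracy provided is near $x_0$, then $|F(x)-\widetilde F_\Delta(x)|\le K_F^f(x_0)\Delta^{N_F^f}$ for all $x\in B_\Delta(x_0)$. In particular, $\{\widetilde F_\Delta\}_{(0,\bar\Delta]}$ provides order-$N_F^f$ function accuracy of $F$ at (respectively near) $x_0$.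
   Context: $B_\Delta(x_0)$ is the closed ball of radius $\Delta$ centered at $x_0$. Empty products equal $1$. A class of models of $f:\mathbb{R}^d\to\mathbb{R}$ is a family of functions $\widetilde f_\Delta:\mathbb{R}^d\to\mathbb{R}$ indexed by $\Delta\in(0,\bar\Delta]$. For real $N\ge0$ and $\kappa\ge0$, it provides order-$N$ function accuracy of $f$ at $x_0$ with constant $\kappa$ if $|f(x_0)-\widetilde f_\Delta(x_0)|\le\kappa\Delta^N$ for all $\Delta\in(0,\bar\Delta]$; near $x_0$ with constant $\kappa$ if $|f(x)-\widetilde f_\Delta(x)|\le\kappa\Delta^N$ for all $\Delta\in(0,\bar\Delta]$ and $x\in B_\Delta(x_0)$. Without mention of a constant, it is meant that some such $\kappa\ge0$ exists. Bounds: $M_{f_i}(x_0)$ denotes a number with $|f_i(x)|\le M_{f_i}(x_0)$ for all $x\in B_{\bar\Delta}(x_0)$. $M_{\widetilde f_i}(x_0)$ denotes a uniform bound for the models: $|\widetilde f_{i,\Delta}(x_0)|\le M_{\widetilde f_i}(x_0)$ for all $\Delta\in(0,\bar\Delta]$ in the "at $x_0$" case, and $|\widetilde f_{i,\Delta}(x)|\le M_{\widetilde f_i}(x_0)$ for all $\Delta\in(0,\bar\Delta]$, $x\in B_\Delta(x_0)$ in the "near $x_0$" case (such a bound exists; one may take $\bar\Delta^{N_i^f}\kappa_i^f(x_0)+M_{f_i}(x_0)$). *)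

theory Defs
  imports "HOL-Analysis.Analysis"
begin

text \<open>
  A class of models of \<open>f\<close> is a family \<open>m :: real \<Rightarrow> real ^ 'd \<Rightarrow> real\<close>, of which only the
  members \<open>m \<Delta>\<close> with \<open>\<Delta> \<in> {0<..D}\<close> matter; \<open>D\<close> is the maximal radius.  The order \<open>N\<close> is a
  real number, so powers of the (positive) radii are taken with \<open>powr\<close>.
\<close>

definition fun_accuracy_at_const ::
  "real \<Rightarrow> (real ^ 'd \<Rightarrow> real) \<Rightarrow> (real \<Rightarrow> real ^ 'd \<Rightarrow> real) \<Rightarrow> real ^ 'd \<Rightarrow> real \<Rightarrow> real \<Rightarrow> bool" where
  "fun_accuracy_at_const D f m x0 N \<kappa> \<longleftrightarrow>
     (\<forall>\<Delta>\<in>{0<..D}. \<bar>f x0 - m \<Delta> x0\<bar> \<le> \<kappa> * \<Delta> powr N)"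

definition fun_accuracy_near_const ::
  "real \<Rightarrow> (real ^ 'd \<Rightarrow> real) \<Rightarrow> (real \<Rightarrow> real ^ 'd \<Rightarrow> real) \<Rightarrow> real ^ 'd \<Rightarrow> real \<Rightarrow> real \<Rightarrow> bool" where
  "fun_accuracy_near_const D f m x0 N \<kappa> \<longleftrightarrow>
     (\<forall>\<Delta>\<in>{0<..D}. \<forall>x\<in>cball x0 \<Delta>. \<bar>f x - m \<Delta> x\<bar> \<le> \<kappa> * \<Delta> powr N)"

definition fun_accuracy_at ::
  "real \<Rightarrow> (real ^ 'd \<Rightarrow> real) \<Rightarrow> (real \<Rightarrow> real ^ 'd \<Rightarrow> real) \<Rightarrow> real ^ 'd \<Rightarrow> real \<Rightarrow> bool" where
  "fun_accuracy_at D f m x0 N \<longleftrightarrow> (\<exists>\<kappa>\<ge>0. fun_accuracy_at_const D f m x0 N \<kappa>)"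

definition fun_accuracy_near ::
  "real \<Rightarrow> (real ^ 'd \<Rightarrow> real) \<Rightarrow> (real \<Rightarrow> real ^ 'd \<Rightarrow> real) \<Rightarrow> real ^ 'd \<Rightarrow> real \<Rightarrow> bool" where
  "fun_accuracy_near D f m x0 N \<longleftrightarrow> (\<exists>\<kappa>\<ge>0. fun_accuracy_near_const D f m x0 N \<kappa>)"

definition is_fun_bound :: "real \<Rightarrow> (real ^ 'd \<Rightarrow> real) \<Rightarrow> real ^ 'd \<Rightarrow> real \<Rightarrow> bool" where
  "is_fun_bound D f x0 M \<longleftrightarrow> (\<forall>x\<in>cball x0 D. \<bar>f x\<bar> \<le> M)"

definition is_model_bound_at ::
  "real \<Rightarrow> (real \<Rightarrow> real ^ 'd \<Rightarrow> real) \<Rightarrow> real ^ 'd \<Rightarrow> real \<Rightarrow> bool" where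
  "is_model_bound_at D m x0 M \<longleftrightarrow> (\<forall>\<Delta>\<in>{0<..D}. \<bar>m \<Delta> x0\<bar> \<le> M)"

definition is_model_bound_near ::
  "real \<Rightarrow> (real \<Rightarrow> real ^ 'd \<Rightarrow> real) \<Rightarrow> real ^ 'd \<Rightarrow> real \<Rightarrow> bool" where
  "is_model_bound_near D m x0 M \<longleftrightarrow> (\<forall>\<Delta>\<in>{0<..D}. \<forall>x\<in>cball x0 \<Delta>. \<bar>m \<Delta> x\<bar> \<le> M)"

definition prod_fun :: "nat \<Rightarrow> (nat \<Rightarrow> real ^ 'd \<Rightarrow> real) \<Rightarrow> real ^ 'd \<Rightarrow> real" where
  "prod_fun n f x = (\<Prod>i=1..n. f i x)"

definition prod_model ::
  "nat \<Rightarrow> (nat \<Rightarrow> real \<Rightarrow> real ^ 'd \<Rightarrow> real) \<Rightarrow> real \<Rightarrow> real ^ 'd \<Rightarrow> real" where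
  "prod_model n m \<Delta> = prod_fun n (\<lambda>i. m i \<Delta>)"

definition prod_order :: "nat \<Rightarrow> (nat \<Rightarrow> real) \<Rightarrow> real" where
  "prod_order n N = Min (N ` {1..n})"

definition prod_const ::
  "nat \<Rightarrow> real \<Rightarrow> (nat \<Rightarrow> real) \<Rightarrow> (nat \<Rightarrow> real) \<Rightarrow> (nat \<Rightarrow> real) \<Rightarrow> (nat \<Rightarrow> real) \<Rightarrow> real" where
  "prod_const n D N \<kappa> Mf Mm =
     Min ((\<lambda>\<sigma>. \<Sum>i=1..n. ((\<Prod>j=1..i-1. Mf (\<sigma> j)) * (\<Prod>k=i+1..n. Mm (\<sigma> k))) * \<kappa> (\<sigma> i)
                 * D powr (N (\<sigma> i) - prod_order n N))
          ` {\<sigma>. \<sigma> permutes {1..n}})"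

end

theory Submission
  imports Defs
begin

text \<open>
  Exchanging the factors one at a time, the product of the \<open>f\<^sub>i\<close> minus the product of the models
  telescopes into a sum whose \<open>i\<close>-th term is the error of the \<open>i\<close>-th model times bounded factors.
  The factors may be exchanged in any order, which gives the minimum over permutations, and
  \<open>\<Delta> powr N\<^sub>i \<le> D powr (N\<^sub>i - N\<^sub>F) * \<Delta> powr N\<^sub>F\<close> reduces all the errors to the lowest order.
\<close>

text \<open>Induction on \<open>n\<close>, splitting off the last factor. Factors before position
  \<open>i\<close> are already bounded by \<open>A\<close>, those after it still by
  \<open>B\<close>; no continuity or radius enters, so any reordering of the factors can be fed
  in.\<close>

lemma abs_prod_diff_le:
  fixes a b A B e :: "nat \<Rightarrow> real"
  assumes "\<And>i. i \<in> {1..n} \<Longrightarrow> \<bar>a i\<bar> \<le> A i"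
    and "\<And>i. i \<in> {1..n} \<Longrightarrow> \<bar>b i\<bar> \<le> B i"
    and "\<And>i. i \<in> {1..n} \<Longrightarrow> \<bar>a i - b i\<bar> \<le> e i"
  shows "\<bar>(\<Prod>i=1..n. a i) - (\<Prod>i=1..n. b i)\<bar>
           \<le> (\<Sum>i=1..n. ((\<Prod>j=1..i-1. A j) * (\<Prod>k=i+1..n. B k)) * e i)"
  using assms
proof (induction n)
  case 0
  then show ?case by simp
next
  case (Suc n)
  let ?S = "\<Sum>i=1..n. ((\<Prod>j=1..i-1. A j) * (\<Prod>k=i+1..n. B k)) * e i"
  have IH: "\<bar>(\<Prod>i=1..n. a i) - (\<Prod>i=1..n. b i)\<bar> \<le> ?S"
    using Suc.prems by (intro Suc.IH) auto
  have a: "\<bar>\<Prod>i=1..n. a i\<bar> \<le> (\<Prod>i=1..n. A i)"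
    unfolding abs_prod using Suc.prems(1) by (intro prod_mono) auto
  \<comment> \<open>The mixed product of \<open>a 1\<close>, ..., \<open>a n\<close> with
    \<open>b (Suc n)\<close> is subtracted and added.\<close>
  have "\<bar>(\<Prod>i=1..Suc n. a i) - (\<Prod>i=1..Suc n. b i)\<bar>
      = \<bar>(\<Prod>i=1..n. a i) * (a (Suc n) - b (Suc n))
          + ((\<Prod>i=1..n. a i) - (\<Prod>i=1..n. b i)) * b (Suc n)\<bar>"
    by (simp add: algebra_simps)
  also have "\<dots> \<le> \<bar>\<Prod>i=1..n. a i\<bar> * \<bar>a (Suc n) - b (Suc n)\<bar>
          + \<bar>(\<Prod>i=1..n. a i) - (\<Prod>i=1..n. b i)\<bar> * \<bar>b (Suc n)\<bar>"
    by (metis abs_mult abs_triangle_ineq)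
  \<comment> \<open>\<open>mult_mono\<close> needs the product of the \<open>A i\<close> and
    \<open>?S\<close> to be nonnegative: both dominate an absolute value, by \<open>a\<close> and
    \<open>IH\<close>.\<close>
  also have "\<dots> \<le> (\<Prod>i=1..n. A i) * e (Suc n) + ?S * B (Suc n)"
    using a IH Suc.prems(2,3)[of "Suc n"] by (intro add_mono mult_mono) auto
  \<comment> \<open>The factor \<open>B (Suc n)\<close> extends each trailing product by one index.
    The term \<open>i = Suc n\<close> is the other summand, its trailing product being
    empty.\<close>
  also have "?S * B (Suc n)
      = (\<Sum>i=1..n. ((\<Prod>j=1..i-1. A j) * (\<Prod>k=i+1..Suc n. B k)) * e i)"
    unfolding sum_distrib_right by (intro sum.cong) auto
  finally show ?case by simp
qed

text \<open>Here \<open>a\<close> and \<open>b\<close> are the values of functions and models at a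
  single point, so one estimate serves both the accuracy at \<open>x0\<close> and the accuracy near
  \<open>x0\<close>.\<close>

lemma prod_const_bound:
  fixes a b \<kappa> N Mf Mm :: "nat \<Rightarrow> real"
  assumes \<Delta>: "\<Delta> \<in> {0<..D}"
    and \<kappa>: "\<And>i. i \<in> {1..n} \<Longrightarrow> \<kappa> i \<ge> 0"
    and a: "\<And>i. i \<in> {1..n} \<Longrightarrow> \<bar>a i\<bar> \<le> Mf i"
    and b: "\<And>i. i \<in> {1..n} \<Longrightarrow> \<bar>b i\<bar> \<le> Mm i"
    and d: "\<And>i. i \<in> {1..n} \<Longrightarrow> \<bar>a i - b i\<bar> \<le> \<kappa> i * \<Delta> powr N i"
  shows "\<bar>(\<Prod>i=1..n. a i) - (\<Prod>i=1..n. b i)\<bar>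
           \<le> prod_const n D N \<kappa> Mf Mm * \<Delta> powr prod_order n N"
proof -
  define NF where "NF = prod_order n N"
  define g where "g \<sigma> = (\<Sum>i=1..n. ((\<Prod>j=1..i-1. Mf (\<sigma> j)) * (\<Prod>k=i+1..n. Mm (\<sigma> k)))
    * \<kappa> (\<sigma> i) * D powr (N (\<sigma> i) - NF))" for \<sigma>
  have d': "\<bar>a i - b i\<bar> \<le> \<kappa> i * D powr (N i - NF) * \<Delta> powr NF" if "i \<in> {1..n}" for i
  proof -
    have "NF \<le> N i"
      unfolding NF_def prod_order_def using that by (intro Min_le) auto
    \<comment> \<open>Monotonicity in the base requires the exponent to be nonnegative, which holds
      because \<open>NF\<close> is the least order.\<close>
    then have "\<Delta> powr (N i - NF) \<le> D powr (N i - NF)"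
      using \<Delta> by (intro powr_mono2) auto
    then have "\<kappa> i * (\<Delta> powr (N i - NF) * \<Delta> powr NF) \<le> \<kappa> i * (D powr (N i - NF) * \<Delta> powr NF)"
      using \<kappa>[OF that] by (intro mult_left_mono mult_right_mono) auto
    with d[OF that] show ?thesis
      by (simp add: mult.assoc flip: powr_add)
  qed
  \<comment> \<open>The minimum over a finite nonempty set is attained, so it suffices to telescope
    in the order of one minimizing permutation.\<close>
  have "finite {\<sigma>. \<sigma> permutes {1..n}}" "id \<in> {\<sigma>. \<sigma> permutes {1..n}}"
    by (auto simp: finite_permutations permutes_id)
  then have "Min (g ` {\<sigma>. \<sigma> permutes {1..n}}) \<in> g ` {\<sigma>. \<sigma> permutes {1..n}}"
    by (intro Min_in) blast+
  then obtain \<sigma> where \<sigma>: "\<sigma> permutes {1..n}" and K: "prod_const n D N \<kappa> Mf Mm = g \<sigma>"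
    unfolding prod_const_def g_def NF_def by auto
  have in_range: "\<sigma> i \<in> {1..n}" if "i \<in> {1..n}" for i
    using that permutes_in_image[OF \<sigma>] by blast
  have "\<bar>(\<Prod>i=1..n. a i) - (\<Prod>i=1..n. b i)\<bar> = \<bar>(\<Prod>i=1..n. a (\<sigma> i)) - (\<Prod>i=1..n. b (\<sigma> i))\<bar>"
    using prod.permute[OF \<sigma>, of a] prod.permute[OF \<sigma>, of b] by (simp add: o_def)
  also have "\<dots> \<le> (\<Sum>i=1..n. ((\<Prod>j=1..i-1. Mf (\<sigma> j)) * (\<Prod>k=i+1..n. Mm (\<sigma> k)))
      * (\<kappa> (\<sigma> i) * D powr (N (\<sigma> i) - NF) * \<Delta> powr NF))"
    by (intro abs_prod_diff_le a b d' in_range)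
  also have "\<dots> = g \<sigma> * \<Delta> powr NF"
    unfolding g_def sum_distrib_right by (simp add: mult.assoc)
  finally show ?thesis
    unfolding K NF_def .
qed

lemma is_fun_bound_exists:
  assumes "continuous_on UNIV f"
  shows "\<exists>M. is_fun_bound D f x0 M"
proof -
  have "compact (f ` cball x0 D)"
    by (intro compact_continuous_image continuous_on_subset[OF assms]) auto
  then show ?thesis
    unfolding is_fun_bound_def by (auto dest!: compact_imp_bounded simp: bounded_iff)
qed

text \<open>Triangle inequality; \<Delta> is replaced by \<open>D\<close> to make the bound uniform
  over all radii, which uses \<open>N \<ge> 0\<close>.\<close>

lemma model_bound:
  fixes y z :: real
  assumes "\<Delta> \<in> {0<..D}" "\<kappa> \<ge> 0" "N \<ge> 0" "\<bar>y\<bar> \<le> M" "\<bar>y - z\<bar> \<le> \<kappa> * \<Delta> powr N"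
  shows "\<bar>z\<bar> \<le> \<kappa> * D powr N + M"
proof -
  have "\<kappa> * \<Delta> powr N \<le> \<kappa> * D powr N"
    using assms by (intro mult_left_mono powr_mono2) auto
  with assms(4,5) show ?thesis by linarith
qed

theorem theorem14:
  fixes n :: nat and x0 :: "real ^ 'd" and D :: real
    and f :: "nat \<Rightarrow> real ^ 'd \<Rightarrow> real"
    and m :: "nat \<Rightarrow> real \<Rightarrow> real ^ 'd \<Rightarrow> real"
    and N \<kappa> :: "nat \<Rightarrow> real"
  assumes "n \<ge> 1" and "D > 0"
    and "\<And>i. i \<in> {1..n} \<Longrightarrow> continuous_on UNIV (f i)"
    and "\<And>i. i \<in> {1..n} \<Longrightarrow> N i \<ge> 0"
    and "\<And>i. i \<in> {1..n} \<Longrightarrow> \<kappa> i \<ge> 0"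
  shows
    "((\<forall>i\<in>{1..n}. fun_accuracy_at_const D (f i) (m i) x0 (N i) (\<kappa> i)) \<longrightarrow>
        (\<forall>Mf Mm. (\<forall>i\<in>{1..n}. is_fun_bound D (f i) x0 (Mf i) \<and> is_model_bound_at D (m i) x0 (Mm i)) \<longrightarrow>
           (\<forall>\<Delta>\<in>{0<..D}. \<bar>prod_fun n f x0 - prod_model n m \<Delta> x0\<bar>
                           \<le> prod_const n D N \<kappa> Mf Mm * \<Delta> powr prod_order n N)) \<and>
        fun_accuracy_at D (prod_fun n f) (prod_model n m) x0 (prod_order n N)) \<and>
     ((\<forall>i\<in>{1..n}. fun_accuracy_near_const D (f i) (m i) x0 (N i) (\<kappa> i)) \<longrightarrow>
        (\<forall>Mf Mm. (\<forall>i\<in>{1..n}. is_fun_bound D (f i) x0 (Mf i) \<and> is_model_bound_near D (m i) x0 (Mm i)) \<longrightarrow>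
           (\<forall>\<Delta>\<in>{0<..D}. \<forall>x\<in>cball x0 \<Delta>. \<bar>prod_fun n f x - prod_model n m \<Delta> x\<bar>
                           \<le> prod_const n D N \<kappa> Mf Mm * \<Delta> powr prod_order n N)) \<and>
        fun_accuracy_near D (prod_fun n f) (prod_model n m) x0 (prod_order n N))"
proof -
  let ?K = "prod_const n D N \<kappa>"
  let ?NF = "prod_order n N"
  note D = assms(2) and cont = assms(3) and N = assms(4) and \<kappa> = assms(5)
  \<comment> \<open>Accuracy without a named constant asks for a nonnegative one. The sign of
    \<open>?K Mf Mm\<close> is read off from the error bound at radius \<open>D\<close>, where
    \<open>D powr ?NF\<close> is positive.\<close>
  have nonneg: "K \<ge> 0" if "\<bar>y\<bar> \<le> K * D powr ?NF" for y K :: real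
  proof -
    have "0 \<le> K * D powr ?NF" using that by linarith
    then show ?thesis using D by (simp add: zero_le_mult_iff)
  qed
  have "\<exists>Mf. \<forall>i\<in>{1..n}. is_fun_bound D (f i) x0 (Mf i)"
    using is_fun_bound_exists cont by (intro bchoice) blast
  then obtain Mf where Mf: "\<And>i. i \<in> {1..n} \<Longrightarrow> is_fun_bound D (f i) x0 (Mf i)"
    by blast
  \<comment> \<open>The right-hand side of \<open>model_bound\<close>; it bounds the models in both
    cases.\<close>
  define Mm where "Mm i = \<kappa> i * D powr N i + Mf i" for i
  show ?thesis
  proof (intro conjI impI)
    assume acc: "\<forall>i\<in>{1..n}. fun_accuracy_at_const D (f i) (m i) x0 (N i) (\<kappa> i)"
    show bound: "\<forall>Mf Mm. (\<forall>i\<in>{1..n}. is_fun_bound D (f i) x0 (Mf i) \<and> is_model_bound_at D (m i) x0 (Mm i)) \<longrightarrow>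
           (\<forall>\<Delta>\<in>{0<..D}. \<bar>prod_fun n f x0 - prod_model n m \<Delta> x0\<bar> \<le> ?K Mf Mm * \<Delta> powr ?NF)"
    proof (intro allI impI ballI)
      fix Mf Mm \<Delta>
      assume M: "\<forall>i\<in>{1..n}. is_fun_bound D (f i) x0 (Mf i) \<and> is_model_bound_at D (m i) x0 (Mm i)"
        and \<Delta>: "\<Delta> \<in> {0<..D}"
      show "\<bar>prod_fun n f x0 - prod_model n m \<Delta> x0\<bar> \<le> ?K Mf Mm * \<Delta> powr ?NF"
        unfolding prod_model_def prod_fun_def
        using M \<Delta> acc D
        by (intro prod_const_bound \<kappa>)
          (auto simp: is_fun_bound_def is_model_bound_at_def fun_accuracy_at_const_def)
    qed
    have "is_model_bound_at D (m i) x0 (Mm i)" if "i \<in> {1..n}" for i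
      unfolding is_model_bound_at_def Mm_def
      using acc Mf[OF that] N[OF that] \<kappa>[OF that] D that
      by (auto simp: is_fun_bound_def fun_accuracy_at_const_def intro!: model_bound[where y = "f i x0"])
    with bound Mf have *: "fun_accuracy_at_const D (prod_fun n f) (prod_model n m) x0 ?NF (?K Mf Mm)"
      unfolding fun_accuracy_at_const_def by blast
    moreover have "?K Mf Mm \<ge> 0"
      by (rule nonneg, rule *[unfolded fun_accuracy_at_const_def, rule_format]) (use D in auto)
    ultimately show "fun_accuracy_at D (prod_fun n f) (prod_model n m) x0 ?NF"
      unfolding fun_accuracy_at_def by blast
  next
    assume acc: "\<forall>i\<in>{1..n}. fun_accuracy_near_const D (f i) (m i) x0 (N i) (\<kappa> i)"
    show bound: "\<forall>Mf Mm. (\<forall>i\<in>{1..n}. is_fun_bound D (f i) x0 (Mf i) \<and> is_model_bound_near D (m i) x0 (Mm i)) \<longrightarrow>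
           (\<forall>\<Delta>\<in>{0<..D}. \<forall>x\<in>cball x0 \<Delta>. \<bar>prod_fun n f x - prod_model n m \<Delta> x\<bar> \<le> ?K Mf Mm * \<Delta> powr ?NF)"
    proof (intro allI impI ballI)
      fix Mf Mm \<Delta> x
      assume M: "\<forall>i\<in>{1..n}. is_fun_bound D (f i) x0 (Mf i) \<and> is_model_bound_near D (m i) x0 (Mm i)"
        and \<Delta>: "\<Delta> \<in> {0<..D}" and x: "x \<in> cball x0 \<Delta>"
      show "\<bar>prod_fun n f x - prod_model n m \<Delta> x\<bar> \<le> ?K Mf Mm * \<Delta> powr ?NF"
        unfolding prod_model_def prod_fun_def
        \<comment> \<open>Since \<Delta> is at most \<open>D\<close>, the point \<open>x\<close>
          also lies in \<open>cball x0 D\<close>, where \<open>Mf\<close> is a bound.\<close>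
        using M \<Delta> acc x
        by (intro prod_const_bound \<kappa>)
          (auto simp: is_fun_bound_def is_model_bound_near_def fun_accuracy_near_const_def)
    qed
    have "is_model_bound_near D (m i) x0 (Mm i)" if i: "i \<in> {1..n}" for i
      unfolding is_model_bound_near_def
    proof (intro ballI)
      fix \<Delta> x
      assume \<Delta>: "\<Delta> \<in> {0<..D}" and x: "x \<in> cball x0 \<Delta>"
      show "\<bar>m i \<Delta> x\<bar> \<le> Mm i"
        unfolding Mm_def
      proof (rule model_bound[OF \<Delta> \<kappa>[OF i] N[OF i]])
        show "\<bar>f i x\<bar> \<le> Mf i"
          using Mf[OF i] \<Delta> x by (auto simp: is_fun_bound_def)
        show "\<bar>f i x - m i \<Delta> x\<bar> \<le> \<kappa> i * \<Delta> powr N i"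
          using acc i \<Delta> x by (auto simp: fun_accuracy_near_const_def)
      qed
    qed
    with bound Mf have *: "fun_accuracy_near_const D (prod_fun n f) (prod_model n m) x0 ?NF (?K Mf Mm)"
      unfolding fun_accuracy_near_const_def by blast
    \<comment> \<open>The bound is evaluated at the center \<open>x0\<close>, which belongs to every
      ball of positive radius.\<close>
    moreover have "?K Mf Mm \<ge> 0"
      by (rule nonneg, rule *[unfolded fun_accuracy_near_const_def, rule_format, where x = x0]) (use D in auto)
    ultimately show "fun_accuracy_near D (prod_fun n f) (prod_model n m) x0 ?NF"
      unfolding fun_accuracy_near_def by blast
  qed
qed

end
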